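(* Let $\mathcal{P}$ be a convex two-dimensional pattern. Then $\mathcal{P}$ is relatively prime if and only if $\mathcal{P}$ is abelian rigid.
   Context: A figure is a finite subset of $\mathbb{Z}^2$; a pattern is the set of all integer translates of a fixed figure. A figure $F$ is convex if $F=\mathrm{conv}_{\mathbb{R}^2}(F)\cap\mathbb{Z}^2$; a pattern is convex if its figures are convex. For a nonzero integer vector $u$, a convex pattern $\mathcal{P}$ with a figure $F$ is $u$-relatively prime if the greatest common divisor of the numbers $|L\cap F|$, taken over all lines $L\subset\mathbb{R}^2$ parallel to $u$ with $L\cap F\neq\emptyset$, equals $1$; $\mathcal{P}$ is relatively prime if it is $u$-relatively prime for every nonzero $u\in\mathbb{Z}^2$. A two-dimensional word is a map $\mathbf{w}:\mathbb{Z}^2\to A$, $A$ a finite alphabet; it is fully periodic if there are two linearly independent $p\in\mathbb{Z}^2$ with $\mathbf{w}(x+p)=\mathbf{w}(x)$ for all $x$. The abelian pattern complexity $a_{\mathbf{w}}(\mathcal{P})$ is the number of abelian equivalence classes of restrictions of $\mathbf{w}$ to figures of $\mathcal{P}$, i.e. the number of distinct vectors $(|\{x\in F':\mathbf{w}(x)=a\}|)_{a\in A}$ for $F'\in\mathcal{P}$. $\mathcal{P}$ is abelian rigid if every word $\mathbf{w}$ with $a_{\mathbf{w}}(\mathcal{P})=1$ is fully periodic. *)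

theory Defs
  imports "HOL-Analysis.Analysis"
begin

type_synonym point = "int \<times> int"
type_synonym figure = "point set"
type_synonym 'a word2 = "point \<Rightarrow> 'a"

definition embed :: "point \<Rightarrow> real \<times> real" where
  "embed x = (real_of_int (fst x), real_of_int (snd x))"

definition translate :: "point \<Rightarrow> figure \<Rightarrow> figure" where
  "translate v F = (\<lambda>x. x + v) ` F"

definition is_pattern :: "figure set \<Rightarrow> bool" where
  "is_pattern P \<longleftrightarrow> (\<exists>F. finite F \<and> P = range (\<lambda>v. translate v F))"

definition convex_figure :: "figure \<Rightarrow> bool" where
  "convex_figure F \<longleftrightarrow> F = {x. embed x \<in> convex hull (embed ` F)}"

definition convex_pattern :: "figure set \<Rightarrow> bool" where
  "convex_pattern P \<longleftrightarrow> is_pattern P \<and> (\<forall>F\<in>P. convex_figure F)"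

definition line_parallel :: "point \<Rightarrow> (real \<times> real) set \<Rightarrow> bool" where
  "line_parallel u L \<longleftrightarrow> (\<exists>p. L = range (\<lambda>t. p + t *\<^sub>R embed u))"

definition points_on :: "(real \<times> real) set \<Rightarrow> figure \<Rightarrow> figure" where
  "points_on L F = {x \<in> F. embed x \<in> L}"

text \<open>The gcd below takes the same value for every figure of a pattern, because the family
  of lines parallel to \<open>u\<close> is translation invariant. For the empty figure it is 0.\<close>

definition dir_relatively_prime :: "point \<Rightarrow> figure set \<Rightarrow> bool" where
  "dir_relatively_prime u P \<longleftrightarrow>
     (\<forall>F\<in>P. Gcd {card (points_on L F) | L. line_parallel u L \<and> points_on L F \<noteq> {}} = 1)"

definition relatively_prime :: "figure set \<Rightarrow> bool" where
  "relatively_prime P \<longleftrightarrow> (\<forall>u. u \<noteq> 0 \<longrightarrow> dir_relatively_prime u P)"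

definition period :: "'a word2 \<Rightarrow> point \<Rightarrow> bool" where
  "period w p \<longleftrightarrow> (\<forall>x. w (x + p) = w x)"

definition fully_periodic :: "'a word2 \<Rightarrow> bool" where
  "fully_periodic w \<longleftrightarrow>
     (\<exists>p q. p \<noteq> q \<and> independent {embed p, embed q} \<and> period w p \<and> period w q)"

definition abelian_vector :: "'a word2 \<Rightarrow> figure \<Rightarrow> 'a \<Rightarrow> nat" where
  "abelian_vector w F a = card {x \<in> F. w x = a}"

definition abelian_complexity :: "'a word2 \<Rightarrow> figure set \<Rightarrow> nat" where
  "abelian_complexity w P = card (abelian_vector w ` P)"

text \<open>Every finite alphabet embeds into \<open>nat\<close>, so the quantification over all finite alphabets
  is rendered by the finite sets of natural numbers; the lemma \<open>abelian_rigid_word\<close>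
  recovers words over an arbitrary letter type.\<close>

definition abelian_rigid :: "figure set \<Rightarrow> bool" where
  "abelian_rigid P \<longleftrightarrow>
     (\<forall>A :: nat set. finite A \<longrightarrow>
       (\<forall>w. range w \<subseteq> A \<and> abelian_complexity w P = 1 \<longrightarrow> fully_periodic w))"

lemma abelian_vector_inj_comp:
  assumes "inj_on f (range w)"
  shows "abelian_vector (f \<circ> w) F =
    (\<lambda>b. if b \<in> f ` range w then abelian_vector w F (the_inv_into (range w) f b) else 0)"
proof
  fix b
  show "abelian_vector (f \<circ> w) F b =
    (if b \<in> f ` range w then abelian_vector w F (the_inv_into (range w) f b) else 0)"
  proof (cases "b \<in> f ` range w")
    case True
    then obtain y where y: "b = f (w y)" by auto
    have "{x \<in> F. f (w x) = b} = {x \<in> F. w x = w y}"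
      using assms y by (auto dest: inj_onD)
    moreover have "the_inv_into (range w) f b = w y"
      using assms y by (simp add: the_inv_into_f_f)
    ultimately show ?thesis using True by (simp add: abelian_vector_def)
  next
    case False
    then have "{x \<in> F. f (w x) = b} = {}" by auto
    then have "abelian_vector (f \<circ> w) F b = 0"
      unfolding abelian_vector_def by (simp only: o_apply card.empty)
    then show ?thesis using False by simp
  qed
qed

lemma abelian_rigid_word:
  fixes w :: "'a word2"
  assumes rigid: "abelian_rigid P" and fin: "finite (range w)"
    and one: "abelian_complexity w P = 1"
  shows "fully_periodic w"
proof -
  obtain f :: "'a \<Rightarrow> nat" where f: "inj_on f (range w)"
    using finite_imp_inj_to_nat_seg[OF fin] by blast
  obtain c where c: "abelian_vector w ` P = {c}"
    using one by (auto simp: abelian_complexity_def card_1_singleton_iff)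
  have "\<And>F. F \<in> P \<Longrightarrow> abelian_vector w F = c" and "P \<noteq> {}"
    using c by auto
  then have "abelian_vector (f \<circ> w) ` P =
      {\<lambda>b. if b \<in> f ` range w then c (the_inv_into (range w) f b) else 0}"
    unfolding abelian_vector_inj_comp[OF f] by (auto simp: image_iff)
  then have "abelian_complexity (f \<circ> w) P = 1"
    unfolding abelian_complexity_def by simp
  moreover have "finite (range (f \<circ> w))"
    unfolding image_comp[symmetric] using fin by (rule finite_imageI)
  ultimately have "fully_periodic (f \<circ> w)"
    using rigid unfolding abelian_rigid_def by blast
  moreover have "period (f \<circ> w) p \<longleftrightarrow> period w p" for p
    using f unfolding period_def by (simp add: inj_on_eq_iff)
  ultimately show ?thesis unfolding fully_periodic_def by blast
qed

end

theory Submission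
  imports Defs "HOL-Library.Poly_Mapping" "HOL-Computational_Algebra.Polynomial"
    "HOL-Computational_Algebra.Primes"
begin

text \<open>Let \<open>w\<close> have constant abelian vectors on the translates of a convex figure \<open>F\<close> containing 0,
  and let \<open>c\<close> be the indicator of a letter. A difference \<open>c'\<close> of \<open>c\<close> is annihilated by the polynomial
  \<open>g = (\<Sum>y\<in>F. X\<^sup>y)\<close> and, being bounded, by the Frobenius property also by \<open>g(X\<^sup>k)\<close> for
  all \<open>k\<close> without small prime factors, in particular for all \<open>k = 1 + i r\<close> with a suitable \<open>r\<close>.
  The right combination of these polynomials over \<open>i\<close> is the product of the binomials
  \<open>1 - X\<^bsup>r v\<^esup>\<close> over \<open>v \<in> F - {0}\<close>, so \<open>c\<close> is annihilated by a product of binomials.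

  A function with finite range, constant \<open>F\<close>-sums and a period \<open>n u\<close>, where \<open>u\<close> is primitive,
  decomposes into eigenfunctions of the shift by \<open>u\<close> with roots of unity as eigenvalues. Each of
  them satisfies a linear recurrence across the lines parallel to \<open>u\<close> whose coefficients are
  geometric sums; these do not all vanish because the line cardinalities have greatest common
  divisor 1. Finite range then forces a second period. This is used to remove the binomials one by one.

  Conversely, if \<open>n \<ge> 2\<close> divides all line cardinalities in direction \<open>u\<close>, residue classes modulo \<open>n\<close>
  along the lines parallel to \<open>u\<close>, with phases chosen aperiodically, give a counterexample.\<close>

section \<open>Laurent polynomials acting on functions\<close>

text \<open>The monoid ring acts on functions by shifts: \<open>single k a\<close> is
  \<open>a\<close> times the shift by \<open>k\<close>. With the sign in \<open>x + k\<close>, the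
  polynomial of a figure \<open>F\<close> sends \<open>c\<close> to its sums over the translates of
  \<open>F\<close>.\<close>

definition act :: "('g::comm_monoid_add \<Rightarrow>\<^sub>0 'b::comm_ring_1) \<Rightarrow> ('g \<Rightarrow> 'b) \<Rightarrow> 'g \<Rightarrow> 'b" where
  "act f c x = (\<Sum>k\<in>Poly_Mapping.keys f. Poly_Mapping.lookup f k * c (x + k))"

abbreviation mono_at :: "'g \<Rightarrow> 'g \<Rightarrow>\<^sub>0 'b::comm_ring_1" where
  "mono_at v \<equiv> Poly_Mapping.single v 1"

lemma act_eq_sum_superset:
  assumes "finite S" "Poly_Mapping.keys f \<subseteq> S"
  shows "act f c x = (\<Sum>k\<in>S. Poly_Mapping.lookup f k * c (x + k))"
  unfolding act_def using assms by (intro sum.mono_neutral_left) (auto simp: in_keys_iff)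

lemma act_add: "act (f + g) c x = act f c x + act g c x"
  using Poly_Mapping.keys_add[of f g]
  by (simp add: act_eq_sum_superset[of "Poly_Mapping.keys f \<union> Poly_Mapping.keys g"]
      lookup_add distrib_right sum.distrib)

lemma act_single: "act (Poly_Mapping.single k a) c x = a * c (x + k)"
  by (simp add: act_eq_sum_superset[of "{k}"])

lemma act_zero [simp]: "act 0 c x = 0"
  by (simp add: act_def)

lemma act_one [simp]: "act 1 c x = c x"
  unfolding single_one[symmetric] act_single by simp

lemma act_diff: "act (f - g) c x = act f c x - act g c x"
  using act_add[of "f - g" g c x] by simp

lemma act_sum: "act (\<Sum>i\<in>I. f i) c x = (\<Sum>i\<in>I. act (f i) c x)"
  by (induction I rule: infinite_finite_induct) (auto simp: act_add)

lemma poly_mapping_single_add_induct [case_names zero add]: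
  assumes "P 0" "\<And>k a f. P f \<Longrightarrow> P (Poly_Mapping.single k a + f)"
  shows "P (f :: 'g \<Rightarrow>\<^sub>0 'b::comm_monoid_add)"
proof -
  have "P (\<Sum>k\<in>S. Poly_Mapping.single k (Poly_Mapping.lookup f k))" if "finite S" for S
    using that by (induction S) (auto intro: assms)
  moreover have "f = (\<Sum>k\<in>Poly_Mapping.keys f. Poly_Mapping.single k (Poly_Mapping.lookup f k))"
    by (rule poly_mapping_eqI) (auto simp: lookup_sum lookup_single when_def in_keys_iff sum.delta)
  ultimately show ?thesis by (metis finite_keys)
qed

lemma act_mult: "act (f * g) c x = act f (act g c) x"
proof (induction f arbitrary: x rule: poly_mapping_single_add_induct)
  case (add k a f)
  have "act (Poly_Mapping.single k a * g) c x = a * act g c (x + k)"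
    by (induction g rule: poly_mapping_single_add_induct)
      (simp_all add: distrib_left act_add mult_single act_single add.assoc mult.assoc)
  then show ?case
    by (simp add: add distrib_right act_add act_single)
qed simp

lemma act_mult_eq_0:
  assumes "\<And>x. act g c x = 0"
  shows "act (f * g) c x = 0"
proof -
  have "act g c = (\<lambda>_. 0)" using assms by auto
  then show ?thesis by (simp add: act_mult act_def[of f])
qed

lemma act_of_nat_mult: "act (of_nat n * f) c x = of_nat n * act f c x"
  unfolding act_mult single_of_nat[symmetric] act_single by simp

text \<open>Shifts commute, so functions derived by \<open>act\<close> from one with constant sums
  over \<open>F\<close> again have constant sums over \<open>F\<close>.\<close>

lemma sum_act: "(\<Sum>y\<in>F. act f c (x + y)) = act f (\<lambda>z. \<Sum>y\<in>F. c (z + y)) x"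
  unfolding act_def by (simp add: sum_distrib_left add_ac sum.swap[of _ F])

lemma finite_range_sum:
  fixes f :: "'i \<Rightarrow> 'x \<Rightarrow> 'b::comm_monoid_add"
  assumes "\<And>i. i \<in> I \<Longrightarrow> finite (range (f i))"
  shows "finite (range (\<lambda>x. \<Sum>i\<in>I. f i x))"
  using assms
proof (induction I rule: infinite_finite_induct)
  case (insert i I)
  have "range (\<lambda>x. \<Sum>j\<in>insert i I. f j x)
      \<subseteq> (\<lambda>(a, b). a + b) ` (range (f i) \<times> range (\<lambda>x. \<Sum>j\<in>I. f j x))"
    using insert by auto
  moreover have "finite \<dots>" using insert by simp
  ultimately show ?case by (rule finite_subset)
qed simp_all

lemma finite_range_mult_shift:
  fixes c :: "'g \<Rightarrow> 'b::times"
  assumes "finite (range c)"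
  shows "finite (range (\<lambda>x. a * c (h x)))"
  by (rule finite_subset[of _ "(*) a ` range c"]) (use assms in auto)

lemma finite_range_act:
  assumes "finite (range c)"
  shows "finite (range (act f c))"
  unfolding act_def by (intro finite_range_sum finite_range_mult_shift assms)

section \<open>Frobenius congruences and products of binomials\<close>

lemma prime_dvd_add_power:
  fixes a b :: "'a::comm_ring_1"
  assumes "prime p"
  shows "of_nat p dvd (a + b) ^ p - a ^ p - b ^ p"
proof -
  have p: "p > 0" using assms prime_gt_0_nat by blast
  have "(a + b) ^ p = (\<Sum>k\<le>p. of_nat (p choose k) * a ^ k * b ^ (p - k))"
    by (rule binomial_ring)
  also have "{..p} = insert 0 (insert p {0<..<p})" using p by auto
  also have "(\<Sum>k\<in>\<dots>. of_nat (p choose k) * a ^ k * b ^ (p - k))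
      = b ^ p + a ^ p + (\<Sum>k\<in>{0<..<p}. of_nat (p choose k) * a ^ k * b ^ (p - k))"
    using p by simp
  finally have "(a + b) ^ p - a ^ p - b ^ p
      = (\<Sum>k\<in>{0<..<p}. of_nat (p choose k) * a ^ k * b ^ (p - k))" by simp
  also have "of_nat p dvd \<dots>"
  proof (rule dvd_sum)
    fix k assume "k \<in> {0<..<p}"
    then have "p dvd (p choose k)" by (intro dvd_choose_prime) (use assms in auto)
    then obtain m where "p choose k = p * m" by blast
    then show "(of_nat p :: 'a) dvd of_nat (p choose k) * a ^ k * b ^ (p - k)"
      by (simp add: mult.assoc)
  qed
  finally show ?thesis .
qed

text \<open>The inner binomial coefficients of a prime exponent \<open>p\<close> are divisible by
  \<open>p\<close>, so taking \<open>p\<close>-th powers is additive modulo \<open>p\<close>;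
  induction passes from two summands to many.\<close>

lemma prime_dvd_sum_power:
  fixes a :: "'i \<Rightarrow> 'a::comm_ring_1"
  assumes "prime p" "finite I"
  shows "of_nat p dvd (\<Sum>i\<in>I. a i) ^ p - (\<Sum>i\<in>I. a i ^ p)"
  using assms(2)
proof (induction I)
  case empty
  then show ?case using assms prime_gt_0_nat[of p] by (simp add: power_0_left)
next
  case (insert i I)
  have "of_nat p dvd ((a i + sum a I) ^ p - a i ^ p - sum a I ^ p) + (sum a I ^ p - (\<Sum>i\<in>I. a i ^ p))"
    by (intro dvd_add prime_dvd_add_power insert.IH assms)
  with insert show ?case by (simp add: algebra_simps)
qed

definition int_scale :: "int \<Rightarrow> point \<Rightarrow> point" where
  "int_scale k v = (k * fst v, k * snd v)"

lemma int_scale_simps [simp]: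
  "int_scale 0 v = 0" "int_scale 1 v = v" "int_scale k 0 = 0"
  "int_scale k (int_scale l v) = int_scale (k * l) v"
  by (auto simp: int_scale_def zero_prod_def)

lemma int_scale_add: "int_scale (k + l) v = int_scale k v + int_scale l v"
  by (simp add: int_scale_def algebra_simps)

lemma int_scale_diff: "int_scale (k - l) v = int_scale k v - int_scale l v"
  by (simp add: int_scale_def algebra_simps)

lemma int_scale_add_right: "int_scale k (v + w) = int_scale k v + int_scale k w"
  by (simp add: int_scale_def algebra_simps)

lemma int_scale_eq_0_iff [simp]: "int_scale k v = 0 \<longleftrightarrow> k = 0 \<or> v = 0"
  by (cases v) (auto simp: int_scale_def zero_prod_def)

lemma mono_at_power:
  "(mono_at v :: point \<Rightarrow>\<^sub>0 'b::comm_ring_1) ^ n = mono_at (int_scale (int n) v)"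
  by (induction n) (simp_all add: mult_single int_scale_add flip: single_one)

text \<open>Modulo \<open>p\<close> the \<open>p\<close>-th power of a figure's polynomial is the polynomial of the \<open>p\<close>-fold
  dilated figure, and an integer divisible by \<open>p\<close> that is smaller than \<open>p\<close> vanishes.\<close>

lemma dilated_sum_eq_0:
  fixes c :: "point \<Rightarrow> int"
  assumes F: "finite F" and c: "\<And>x. \<bar>c x\<bar> \<le> M"
    and zero: "\<And>x. (\<Sum>y\<in>F. c (x + y)) = 0"
    and k: "k > 0" "\<And>p. prime p \<Longrightarrow> p dvd k \<Longrightarrow> int p > int (card F) * M"
  shows "(\<Sum>y\<in>F. c (x + int_scale (int k) y)) = 0"
  using k
proof (induction k arbitrary: x rule: less_induct)
  case (less k)
  show ?case
  proof (cases "k = 1")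
    case True
    then show ?thesis using zero by simp
  next
    case False
    \<comment> \<open>One prime factor is stripped from \<open>k\<close>. The dilation by
      \<open>m\<close> is covered by induction, and with \<open>G m\<close> its \<open>p\<close>-th
      power annihilates \<open>c\<close> as well.\<close>
    then obtain p where p: "prime p" "p dvd k" using prime_factor_nat by blast
    then obtain m where m: "k = p * m" by blast
    have "m > 0" "m < k" using m less.prems(1) prime_gt_1_nat[OF p(1)] by auto
    define G :: "nat \<Rightarrow> point \<Rightarrow>\<^sub>0 int"
      where "G i = (\<Sum>y\<in>F. mono_at (int_scale (int i) y))" for i
    have G: "act (G i) c x = (\<Sum>y\<in>F. c (x + int_scale (int i) y))" for i x
      by (simp add: G_def act_sum act_single)
    have "act (G m) c x = 0" for x
      unfolding G by (rule less.IH) (use \<open>m > 0\<close> \<open>m < k\<close> less.prems m in auto)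
    then have "act (G m ^ (p - 1) * G m) c x = 0" for x
      by (rule act_mult_eq_0)
    then have pow: "act (G m ^ p) c x = 0" for x
      using prime_gt_0_nat[OF p(1)] by (metis power_minus_mult)
    have "of_nat p dvd G m ^ p - (\<Sum>y\<in>F. mono_at (int_scale (int m) y) ^ p)"
      unfolding G_def by (rule prime_dvd_sum_power[OF p(1) F])
    also have "(\<Sum>y\<in>F. (mono_at (int_scale (int m) y) :: point \<Rightarrow>\<^sub>0 int) ^ p) = G k"
      by (simp add: mono_at_power G_def m)
    finally obtain h where h: "G m ^ p - G k = of_nat p * h" by blast
    have "- act (G k) c x = int p * act h c x"
      using arg_cong[OF h, of "\<lambda>f. act f c x"] by (simp add: act_diff pow act_of_nat_mult)
    then have "int p dvd act (G k) c x" by (metis dvd_minus_iff dvd_triv_left)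
    moreover have "\<bar>act (G k) c x\<bar> < int p"
    proof -
      have "\<bar>act (G k) c x\<bar> \<le> (\<Sum>y\<in>F. \<bar>c (x + int_scale (int k) y)\<bar>)"
        unfolding G by (rule sum_abs)
      also have "\<dots> \<le> int (card F) * M" using c by (intro sum_bounded_above) auto
      also have "\<dots> < int p" using less.prems p by blast
      finally show ?thesis .
    qed
    ultimately show ?thesis unfolding G using zdvd_not_zless by (metis abs_of_nat dvd_imp_le_int not_le)
  qed
qed

lemma prod_binomials_annihilates:
  fixes c :: "point \<Rightarrow> int"
  assumes F: "finite F" "0 \<in> F" and c: "finite (range c)"
    and zero: "\<And>x. (\<Sum>y\<in>F. c (x + y)) = 0"
  obtains r where "r > 0" "\<And>x. act (\<Prod>v\<in>F - {0}. 1 - mono_at (int_scale r v)) c x = 0"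
proof -
  define M where "M = Max (range (\<lambda>x. \<bar>c x\<bar>))"
  have "finite (range (\<lambda>x. \<bar>c x\<bar>))"
    using finite_imageI[OF c, of abs] by (simp add: image_image)
  then have M: "\<bar>c x\<bar> \<le> M" for x by (simp add: M_def)
  \<comment> \<open>As \<open>r\<close> is the factorial of \<open>B\<close>, every prime factor of
    \<open>1 + i * r\<close> exceeds \<open>B\<close> and thus the bound demanded by
    \<open>dilated_sum_eq_0\<close>.\<close>
  define B where "B = card F * nat M"
  define r where "r = (fact B :: nat)"
  have big: "int p > int (card F) * M" if p: "prime p" "p dvd 1 + i * r" for p i
  proof -
    have "\<not> p dvd r"
    proof
      assume "p dvd r"
      then have "p dvd (1 + i * r) - i * r" using p by (intro dvd_diff_nat) auto
      then show False using p(1) by simp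
    qed
    then have "B < p" using p(1) by (simp add: r_def prime_dvd_fact_iff)
    moreover have "M \<ge> 0" using M[of 0] by simp
    ultimately show ?thesis unfolding B_def by (metis int_nat_eq of_nat_less_iff of_nat_mult)
  qed
  define G :: "nat \<Rightarrow> point \<Rightarrow>\<^sub>0 int"
    where "G i = (\<Sum>y\<in>F. mono_at (int_scale (int i) y))" for i
  have G: "act (G (1 + i * r)) c x = 0" for i x
    using dilated_sum_eq_0[OF F(1) M zero, of "1 + i * r" x] big
    by (simp add: G_def act_sum act_single)
  define X :: "point \<Rightarrow> point \<Rightarrow>\<^sub>0 int" where "X v = mono_at (int_scale (int r) v)" for v
  \<comment> \<open>\<open>Q\<close> has coefficients in the Laurent ring and the roots
    \<open>X v\<close>. Weighting \<open>G (1 + i * r)\<close> by its coefficients gives the sum of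
    all \<open>mono_at y * poly Q (X y)\<close>. Only \<open>y = 0\<close> survives, where
    \<open>X 0 = 1\<close> leaves the product of binomials.\<close>
  define Q where "Q = (\<Prod>v\<in>F - {0}. [:- X v, 1:])"
  have "(\<Sum>i\<le>degree Q. coeff Q i * G (1 + i * r)) = (\<Sum>y\<in>F. mono_at y * poly Q (X y))"
  proof -
    have "mono_at y * poly Q (X y)
        = (\<Sum>i\<le>degree Q. coeff Q i * mono_at (int_scale (int (1 + i * r)) y))" for y
      unfolding poly_altdef X_def mono_at_power sum_distrib_left
      by (intro sum.cong refl, subst mult.left_commute) (simp add: mult_single int_scale_add)
    then show ?thesis unfolding G_def by (simp add: sum_distrib_left sum.swap[of _ F])
  qed
  also have "\<dots> = (\<Sum>y\<in>{0}. mono_at y * poly Q (X y))"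
  proof (rule sum.mono_neutral_right)
    show "\<forall>y\<in>F - {0}. mono_at y * poly Q (X y) = 0"
    proof
      fix y assume "y \<in> F - {0}"
      then have "(\<Prod>v\<in>F - {0}. X y - X v) = 0"
        using F(1) by (intro prod_zero) auto
      then show "mono_at y * poly Q (X y) = 0" by (simp add: Q_def poly_prod)
    qed
  qed (use F in auto)
  also have "\<dots> = (\<Prod>v\<in>F - {0}. 1 - X v)"
    by (simp add: Q_def poly_prod X_def)
  finally have "(\<Prod>v\<in>F - {0}. 1 - X v) = (\<Sum>i\<le>degree Q. coeff Q i * G (1 + i * r))" ..
  then have "act (\<Prod>v\<in>F - {0}. 1 - X v) c x = 0" for x
    by (simp only: act_sum act_mult_eq_0[OF G] sum.neutral_const)
  moreover have "int r > 0" by (simp add: r_def)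
  ultimately show thesis using that[of "int r"] unfolding X_def by blast
qed

section \<open>Periods\<close>

lemma periodI:
  assumes "\<And>x. f (x + p) = f x"
  shows "period f p"
  unfolding period_def using assms by blast

lemma periodD: "period f p \<Longrightarrow> f (x + p) = f x"
  unfolding period_def by blast

lemma add_int_scale_Suc: "x + int_scale (int (Suc k)) p = x + int_scale (int k) p + p"
  by (simp only: of_nat_Suc int_scale_add int_scale_simps add_ac)

lemma period_add:
  assumes "period f p" "period f q"
  shows "period f (p + q)"
  by (intro periodI) (simp add: periodD[OF assms(1)] periodD[OF assms(2)] flip: add.assoc)

lemma period_int_scale:
  assumes "period f p"
  shows "period f (int_scale k p)"
proof -
  have nat: "f (x + int_scale (int n) p) = f x" for n x
  proof (induction n)
    case (Suc n)
    then show ?case unfolding add_int_scale_Suc using periodD[OF assms] by metis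
  qed simp
  show ?thesis
  proof (cases "k \<ge> 0")
    case True
    then show ?thesis using nat[of _ "nat k"] by (intro periodI) simp
  next
    case False
    have "f (x + int_scale k p) = f x" for x
      using nat[of "x + int_scale k p" "nat (- k)"] False
      by (simp add: add.assoc flip: int_scale_add)
    then show ?thesis by (rule periodI)
  qed
qed

text \<open>Equivalent to full periodicity, but with one integer \<open>K\<close> for all
  directions, common periods of several functions come from common multiples.\<close>

definition lattice_periodic :: "'a word2 \<Rightarrow> bool" where
  "lattice_periodic f \<longleftrightarrow> (\<exists>K>0. \<forall>v. period f (int_scale K v))"

text \<open>By assumption the square of \<open>1 - mono_at v\<close> annihilates \<open>e\<close>,
  so \<open>e\<close> is affine along progressions with step \<open>v\<close>. An affine integer
  sequence with finitely many values is constant.\<close>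

lemma period_if_second_difference_zero:
  fixes e :: "point \<Rightarrow> int"
  assumes fin: "finite (range e)" and per: "period (\<lambda>x. e x - e (x + v)) v"
  shows "period e v"
proof (rule periodI)
  fix x
  define s where "s = e x - e (x + v)"
  have step: "e (x + int_scale (int m) v) - e (x + int_scale (int m) v + v) = s" for m
    using periodD[OF period_int_scale[OF per, of "int m"], of x] by (simp add: s_def)
  have lin: "e (x + int_scale (int m) v) = e x - int m * s" for m
  proof (induction m)
    case (Suc m)
    have "int (Suc m) * s = s + int m * s" by (simp add: distrib_right)
    then show ?case unfolding add_int_scale_Suc using step[of m] Suc by linarith
  qed simp
  have "s = 0"
  proof (rule ccontr)
    assume "s \<noteq> 0"
    then have "inj (\<lambda>m. e (x + int_scale (int m) v))"
      unfolding lin by (auto simp: inj_def)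
    moreover have "finite (range (\<lambda>m. e (x + int_scale (int m) v)))"
      by (rule finite_subset[OF _ fin]) auto
    ultimately show False using finite_imageD infinite_UNIV_nat by blast
  qed
  then show "e (x + v) = e x" by (simp add: s_def)
qed

text \<open>By \<open>det\<close>, a window of \<open>D\<close> consecutive values along
  \<open>w\<close> determines the next value, by a rule that is the same everywhere. All later
  values are then functions of the window, and there are only finitely many such functions. When two
  of them coincide, one period results for all lines at once.\<close>

lemma finite_state_periodic:
  fixes d :: "point \<Rightarrow> 'a"
  assumes fin: "finite (range d)"
    and det: "\<And>x x'. (\<And>i. i < D \<Longrightarrow> d (x + int_scale (int i) w) = d (x' + int_scale (int i) w))
      \<Longrightarrow> d (x + int_scale (int D) w) = d (x' + int_scale (int D) w)"
  shows "\<exists>N>0. period d (int_scale N w)"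
proof -
  define s where "s x = restrict (\<lambda>i. d (x + int_scale (int i) w)) {..<D}" for x
  have future: "d (x + int_scale (int k) w) = d (x' + int_scale (int k) w)" if "s x = s x'" for x x' k
  proof (induction k rule: less_induct)
    case (less k)
    show ?case
    proof (cases "k < D")
      case True
      then show ?thesis using fun_cong[OF that, of k] by (simp add: s_def)
    next
      case False
      have shift: "z + int_scale (int k - int D) w + int_scale (int i) w
          = z + int_scale (int (k - D + i)) w" for z i
      proof -
        have "int (k - D + i) = int k - int D + int i" using False by simp
        then show ?thesis by (simp only: int_scale_add add.assoc)
      qed
      have "d (x + int_scale (int k - int D) w + int_scale (int D) w)
          = d (x' + int_scale (int k - int D) w + int_scale (int D) w)"
        by (rule det, unfold shift, rule less.IH) (use False in auto)
      then show ?thesis by (simp add: add.assoc flip: int_scale_add)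
    qed
  qed
  \<comment> \<open>By \<open>future\<close>, \<open>R k\<close> is the graph of the function from
    the window at \<open>x\<close> to the value \<open>k\<close> steps later. Since \<open>x\<close>
    is arbitrary, it can finally be moved back by \<open>i\<close> steps, so the periodicity is not
    merely eventual.\<close>
  define R where "R k = range (\<lambda>x. (s x, d (x + int_scale (int k) w)))" for k
  let ?T = "({..<D} \<rightarrow>\<^sub>E range d) \<times> range d"
  have "s x \<in> {..<D} \<rightarrow>\<^sub>E range d" for x
    unfolding s_def restrict_PiE_iff by blast
  then have "range R \<subseteq> Pow ?T" by (auto simp: R_def)
  moreover have "finite (Pow ?T)"
    using fin by (intro iffD2[OF finite_Pow_iff] finite_SigmaI finite_PiE) auto
  ultimately have "finite (range R)" by (rule finite_subset)
  then have "\<not> inj R" using finite_imageD infinite_UNIV_nat by blast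
  then obtain i' j' where "R i' = R j'" "i' \<noteq> j'" unfolding inj_def by blast
  then have "\<exists>i j. i < j \<and> R i = R j"
    by (metis linorder_less_linear)
  then obtain i j where ij: "i < j" "R i = R j" by blast
  have "d (x + int_scale (int i) w) = d (x + int_scale (int j) w)" for x
  proof -
    have "(s x, d (x + int_scale (int i) w)) \<in> R i" unfolding R_def by (rule image_eqI[of _ _ x]) simp_all
    then have "(s x, d (x + int_scale (int i) w)) \<in> R j" by (simp only: ij(2))
    then obtain x' where "s x = s x'" "d (x + int_scale (int i) w) = d (x' + int_scale (int j) w)"
      by (auto simp: R_def simp del: split_paired_Ex split_paired_All)
    then show ?thesis using future[of x x' j] by simp
  qed
  from this[of "x - int_scale (int i) w" for x]
  have "d (x + int_scale (int j - int i) w) = d x" for x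
    by (simp add: int_scale_diff algebra_simps)
  then have "period d (int_scale (int j - int i) w)" by (rule periodI)
  then show ?thesis using ij(1) by (intro exI[of _ "int j - int i"]) auto
qed

lemma linear_recurrence_periodic:
  fixes d :: "point \<Rightarrow> 'b::field"
  assumes fin: "finite (range d)" and B: "finite B" "\<beta> \<in> B" "\<gamma> \<beta> \<noteq> 0"
    and rec: "\<And>x. (\<Sum>b\<in>B. \<gamma> b * d (x + int_scale b w)) = \<kappa>"
  shows "\<exists>N>0. period d (int_scale N w)"
proof -
  define C where "C = {b \<in> B. \<gamma> b \<noteq> 0}"
  have C: "finite C" "C \<noteq> {}" using B by (auto simp: C_def)
  \<comment> \<open>The order of the recurrence, which is solved for its top term. Indices may be
    negative, so they are counted from \<open>Min C\<close>. If only one coefficient is nonzero,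
    \<open>D = 0\<close> and \<open>d\<close> is constant.\<close>
  define D where "D = nat (Max C - Min C)"
  have D: "int D = Max C - Min C" using C by (simp add: D_def)
  have "d (x + int_scale (int D) w) = d (x' + int_scale (int D) w)"
    if eq: "\<And>i. i < D \<Longrightarrow> d (x + int_scale (int i) w) = d (x' + int_scale (int i) w)" for x x'
  proof -
    have top: "\<gamma> (Max C) * d (z + int_scale (int D) w)
        = \<kappa> - (\<Sum>b\<in>C - {Max C}. \<gamma> b * d (z + int_scale (b - Min C) w))" for z
    proof -
      have "\<kappa> = (\<Sum>b\<in>B. \<gamma> b * d (z - int_scale (Min C) w + int_scale b w))" by (simp add: rec)
      also have "\<dots> = (\<Sum>b\<in>C. \<gamma> b * d (z + int_scale (b - Min C) w))"
        using B(1) unfolding C_def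
        by (intro sum.mono_neutral_cong_right) (auto simp: int_scale_diff algebra_simps)
      also have "\<dots> = \<gamma> (Max C) * d (z + int_scale (Max C - Min C) w)
          + (\<Sum>b\<in>C - {Max C}. \<gamma> b * d (z + int_scale (b - Min C) w))"
        using C by (intro sum.remove) auto
      finally show ?thesis by (simp add: D)
    qed
    have "d (x + int_scale (b - Min C) w) = d (x' + int_scale (b - Min C) w)" if "b \<in> C - {Max C}" for b
    proof -
      have "Min C \<le> b" "b < Max C" using that C by (auto simp: order.not_eq_order_implies_strict)
      then show ?thesis using eq[of "nat (b - Min C)"] D by simp
    qed
    then have "\<gamma> (Max C) * d (x + int_scale (int D) w) = \<gamma> (Max C) * d (x' + int_scale (int D) w)"
      unfolding top by simp
    moreover have "\<gamma> (Max C) \<noteq> 0" using Max_in[OF C] by (simp add: C_def)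
    ultimately show ?thesis by simp
  qed
  then show ?thesis by (rule finite_state_periodic[OF fin])
qed

section \<open>Lattice lines and convex figures\<close>

text \<open>For \<open>u \<noteq> 0\<close> the linear form \<open>det2 u\<close> takes a different
  constant value on each line parallel to \<open>u\<close> and so labels these lines.\<close>

definition det2 :: "point \<Rightarrow> point \<Rightarrow> int" where
  "det2 u v = fst u * snd v - snd u * fst v"

lemma det2_add: "det2 u (v + w) = det2 u v + det2 u w"
  by (simp add: det2_def algebra_simps)

lemma det2_add_left: "det2 (u + v) w = det2 u w + det2 v w"
  by (simp add: det2_def algebra_simps)

lemma det2_int_scale [simp]:
  "det2 u (int_scale k v) = k * det2 u v" "det2 (int_scale k u) v = k * det2 u v"
  by (simp_all add: det2_def int_scale_def algebra_simps)

lemma det2_self [simp]: "det2 u u = 0"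
  by (simp add: det2_def)

lemma complementary_vector:
  assumes "coprime (fst u) (snd u)"
  obtains w where "det2 u w = 1"
proof -
  obtain r s where "r * fst u + s * snd u = 1"
    using bezout_int[of "fst u" "snd u"] assms by auto
  then show thesis using that[of "(- s, r)"] by (simp add: det2_def algebra_simps)
qed

lemma basis_coordinates:
  assumes "det2 u w = 1"
  shows "y = int_scale (det2 y w) u + int_scale (det2 u y) w"
proof -
  have "fst y * det2 u w = det2 y w * fst u + det2 u y * fst w"
    "snd y * det2 u w = det2 y w * snd u + det2 u y * snd w"
    by (simp_all add: det2_def algebra_simps)
  then show ?thesis by (auto simp: assms int_scale_def prod_eq_iff)
qed

lemma primitive_vector:
  assumes "v \<noteq> 0"
  obtains n u where "n > 0" "v = int_scale (int n) u" "coprime (fst u) (snd u)"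
proof -
  define g where "g = gcd (fst v) (snd v)"
  have g: "g > 0" using assms by (auto simp: g_def zero_prod_def prod_eq_iff)
  have "coprime (fst v div g) (snd v div g)"
    unfolding g_def by (rule div_gcd_coprime) (use assms in \<open>auto simp: zero_prod_def prod_eq_iff\<close>)
  moreover have "v = int_scale (int (nat g)) (fst v div g, snd v div g)"
    using g by (simp add: int_scale_def g_def prod_eq_iff)
  ultimately show thesis using that[of "nat g" "(fst v div g, snd v div g)"] g by simp
qed

definition lattice_row :: "point \<Rightarrow> figure \<Rightarrow> int \<Rightarrow> figure" where
  "lattice_row u F b = {y \<in> F. det2 u y = b}"

text \<open>The line cardinalities of \<open>dir_relatively_prime\<close>, with integer labels in
  place of real lines. Taking labels from the image of \<open>F\<close> excludes empty rows.\<close>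

definition row_cards :: "point \<Rightarrow> figure \<Rightarrow> nat set" where
  "row_cards u F = (\<lambda>b. card (lattice_row u F b)) ` det2 u ` F"

lemma points_on_eq_row:
  assumes u: "u \<noteq> 0" and L: "line_parallel u L" and y: "embed y \<in> L"
  shows "points_on L F = lattice_row u F (det2 u y)"
proof -
  obtain p where p: "L = range (\<lambda>t. p + t *\<^sub>R embed u)" using L by (auto simp: line_parallel_def)
  obtain s where s: "embed y = p + s *\<^sub>R embed u" using y p by auto
  have "embed z \<in> L \<longleftrightarrow> det2 u z = det2 u y" for z
  proof
    assume "embed z \<in> L"
    then obtain t where t: "embed z = p + t *\<^sub>R embed u" using p by auto
    have "real_of_int (det2 u z) = real_of_int (det2 u y)"
      using s t by (simp add: embed_def prod_eq_iff det2_def algebra_simps)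
    then show "det2 u z = det2 u y" by linarith
  next
    assume "det2 u z = det2 u y"
    then have eq: "real_of_int (fst u) * (real_of_int (snd z) - real_of_int (snd y))
        = real_of_int (snd u) * (real_of_int (fst z) - real_of_int (fst y))"
      unfolding det2_def by (simp flip: of_int_mult of_int_diff add: algebra_simps)
    have "\<exists>t. embed z = embed y + t *\<^sub>R embed u"
    proof (cases "fst u = 0")
      case True
      then have "snd u \<noteq> 0" using u by (auto simp: zero_prod_def prod_eq_iff)
      then show ?thesis using True eq
        by (intro exI[of _ "(real_of_int (snd z) - real_of_int (snd y)) / real_of_int (snd u)"])
          (simp add: embed_def)
    next
      case False
      then show ?thesis using eq
        by (intro exI[of _ "(real_of_int (fst z) - real_of_int (fst y)) / real_of_int (fst u)"])
          (simp add: embed_def field_simps)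
    qed
    then obtain t where "embed z = p + (s + t) *\<^sub>R embed u"
      unfolding s by (auto simp: scaleR_left_distrib add.assoc)
    then show "embed z \<in> L" using p by blast
  qed
  then show ?thesis by (auto simp: points_on_def lattice_row_def)
qed

lemma dir_relatively_prime_iff:
  assumes "u \<noteq> 0"
  shows "dir_relatively_prime u P \<longleftrightarrow> (\<forall>F\<in>P. Gcd (row_cards u F) = 1)"
proof -
  have "{card (points_on L F) | L. line_parallel u L \<and> points_on L F \<noteq> {}} = row_cards u F" for F
  proof (intro equalityI subsetI)
    fix k assume "k \<in> {card (points_on L F) | L. line_parallel u L \<and> points_on L F \<noteq> {}}"
    then obtain L where L: "k = card (points_on L F)" "line_parallel u L" "points_on L F \<noteq> {}" by auto
    then obtain y where "y \<in> F" "embed y \<in> L" by (auto simp: points_on_def)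
    then show "k \<in> row_cards u F"
      using points_on_eq_row[OF assms L(2)] L(1) by (auto simp: row_cards_def)
  next
    fix k assume "k \<in> row_cards u F"
    then obtain y where y: "y \<in> F" "k = card (lattice_row u F (det2 u y))" by (auto simp: row_cards_def)
    define L where "L = range (\<lambda>t. embed y + t *\<^sub>R embed u)"
    have "embed y + 0 *\<^sub>R embed u \<in> L" unfolding L_def by blast
    then have "embed y \<in> L" by simp
    moreover have "line_parallel u L" unfolding line_parallel_def L_def by blast
    ultimately have L: "line_parallel u L" "embed y \<in> L" by auto
    have "y \<in> points_on L F" using y L by (simp add: points_on_def)
    then show "k \<in> {card (points_on L F) | L. line_parallel u L \<and> points_on L F \<noteq> {}}"
      using L y by (intro CollectI exI[of _ L]) (auto simp: points_on_eq_row[OF assms L])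
  qed
  then show ?thesis by (simp add: dir_relatively_prime_def)
qed

text \<open>Scaling \<open>u\<close> only relabels the rows, so directions can be reduced to
  primitive ones.\<close>

lemma row_cards_int_scale:
  assumes "k \<noteq> 0"
  shows "row_cards (int_scale k u) F = row_cards u F"
  using assms by (simp add: row_cards_def lattice_row_def image_image)

lemma interval_closed_int_set:
  fixes A :: "int set"
  assumes "finite A" "A \<noteq> {}" "\<And>s r t. s \<in> A \<Longrightarrow> r \<in> A \<Longrightarrow> s \<le> t \<Longrightarrow> t \<le> r \<Longrightarrow> t \<in> A"
  shows "A = {Min A..Max A}"
  using assms(1,2) by (auto intro: assms(3)[OF Min_in Max_in])

lemma convex_figure_segment:
  assumes F: "convex_figure F" and y: "y \<in> F" "y + int_scale m u \<in> F" and j: "0 \<le> j" "j \<le> m"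
  shows "y + int_scale j u \<in> F"
proof (cases "m = 0")
  case True
  then show ?thesis using j y by simp
next
  case False
  define t where "t = real_of_int j / real_of_int m"
  have tm: "t * real_of_int m = real_of_int j" using False by (simp add: t_def)
  have "embed (y + int_scale j u) = (1 - t) *\<^sub>R embed y + t *\<^sub>R embed (y + int_scale m u)"
    by (simp add: embed_def int_scale_def algebra_simps flip: tm)
  also have "\<dots> \<in> convex hull (embed ` F)"
    by (rule convexD_alt) (use y j False in \<open>auto simp: t_def hull_inc\<close>)
  finally show ?thesis using F by (auto simp: convex_figure_def)
qed

text \<open>On a line parallel to a primitive \<open>u\<close>, neighbouring lattice points differ
  by \<open>u\<close>, and convexity leaves no gaps between points of the figure. Convexity enters
  the argument only through this progression.\<close>

lemma row_progression:
  assumes F: "convex_figure F" "finite F" and u: "coprime (fst u) (snd u)" and ne: "lattice_row u F b \<noteq> {}"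
  obtains p where "det2 u p = b"
    "bij_betw (\<lambda>i. p + int_scale (int i) u) {..<card (lattice_row u F b)} (lattice_row u F b)"
proof -
  obtain w where w: "det2 u w = 1" using complementary_vector[OF u] .
  define a where "a y = det2 y w" for y
  have split: "y = int_scale (a y) u + int_scale b w" if "y \<in> lattice_row u F b" for y
    using basis_coordinates[OF w, of y] that by (simp add: a_def lattice_row_def)
  have diff: "z = y + int_scale (a z - a y) u" if "y \<in> lattice_row u F b" "z \<in> lattice_row u F b" for y z
  proof -
    have "z - y = int_scale (a z) u - int_scale (a y) u"
      using arg_cong2[OF split[OF that(2)] split[OF that(1)], of "(-)"] by simp
    also have "\<dots> = int_scale (a z - a y) u" by (rule int_scale_diff[symmetric])
    finally show ?thesis by (metis add.commute diff_add_cancel)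
  qed
  define A where "A = a ` lattice_row u F b"
  have fin: "finite (lattice_row u F b)" using F(2) by (simp add: lattice_row_def)
  have A: "finite A" "A \<noteq> {}" using fin ne by (auto simp: A_def)
  have "t \<in> A" if srt: "s \<in> A" "r \<in> A" "s \<le> t" "t \<le> r" for s r t
  proof -
    obtain y z where yz: "y \<in> lattice_row u F b" "z \<in> lattice_row u F b" "s = a y" "r = a z"
      using srt by (auto simp: A_def)
    have "z = y + int_scale (r - s) u" using diff[OF yz(1,2)] unfolding yz .
    then have "y + int_scale (t - s) u \<in> F"
      using convex_figure_segment[OF F(1), of y "r - s" u "t - s"] yz srt by (auto simp: lattice_row_def)
    then have "y + int_scale (t - s) u \<in> lattice_row u F b"
      using yz by (simp add: lattice_row_def det2_add)
    moreover have "a (y + int_scale (t - s) u) = t" using yz w by (simp add: a_def det2_add_left)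
    ultimately show ?thesis unfolding A_def by force
  qed
  then have AI: "A = {Min A..Max A}" using A by (intro interval_closed_int_set)
  have "inj_on a (lattice_row u F b)" by (rule inj_onI) (metis diff diff_self int_scale_simps(1) add.right_neutral)
  then have "card (lattice_row u F b) = card A" by (simp add: A_def card_image)
  also have "card A = nat (Max A - Min A + 1)" using AI by (metis card_atLeastAtMost_int diff_add_eq)
  finally have card: "card (lattice_row u F b) = nat (Max A - Min A + 1)" .
  have "Min A \<in> A" using A by simp
  then obtain p where p: "p \<in> lattice_row u F b" "a p = Min A" by (auto simp: A_def)
  have "bij_betw (\<lambda>i. p + int_scale (int i) u) {..<card (lattice_row u F b)} (lattice_row u F b)"
    unfolding bij_betw_def
  proof
    have "u \<noteq> 0" using u by (auto simp: zero_prod_def)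
    then have "int i = int j" if "int_scale (int i) u = int_scale (int j) u" for i j
      using that int_scale_eq_0_iff[of "int i - int j" u] by (simp add: int_scale_diff)
    then show "inj_on (\<lambda>i. p + int_scale (int i) u) {..<card (lattice_row u F b)}"
      by (auto simp: inj_on_def)
    show "(\<lambda>i. p + int_scale (int i) u) ` {..<card (lattice_row u F b)} = lattice_row u F b"
    proof (intro equalityI subsetI)
      fix z assume "z \<in> (\<lambda>i. p + int_scale (int i) u) ` {..<card (lattice_row u F b)}"
      then obtain i where i: "z = p + int_scale (int i) u" "int i \<le> Max A - Min A"
        by (auto simp: card)
      then have "Min A + int i \<in> {Min A..Max A}" by simp
      then have "Min A + int i \<in> A" by (simp only: AI[symmetric])
      then obtain y where y: "y \<in> lattice_row u F b" "a y = Min A + int i" by (auto simp: A_def)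
      have "z = y" using diff[OF p(1) y(1)] y(2) p(2) i(1) by simp
      then show "z \<in> lattice_row u F b" using y by simp
    next
      fix y assume y: "y \<in> lattice_row u F b"
      then have "a y \<in> A" by (simp add: A_def)
      then have "Min A \<le> a y" "a y \<le> Max A" using A by auto
      then show "y \<in> (\<lambda>i. p + int_scale (int i) u) ` {..<card (lattice_row u F b)}"
        using diff[OF p(1) y] p(2)
        by (intro image_eqI[of _ _ "nat (a y - Min A)"]) (simp_all add: card)
    qed
  qed
  moreover have "det2 u p = b" using p by (simp add: lattice_row_def)
  ultimately show thesis using that by blast
qed

lemma sum_rows:
  assumes "finite F"
  shows "(\<Sum>y\<in>F. f y) = (\<Sum>b\<in>det2 u ` F. \<Sum>y\<in>lattice_row u F b. f y)"
  unfolding lattice_row_def using assms by (rule sum.image_gen)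

section \<open>A second period\<close>

lemma root_of_unity_Gcd:
  fixes z :: "'b::field"
  assumes "finite S" "\<And>k. k \<in> S \<Longrightarrow> z ^ k = 1"
  shows "z ^ Gcd S = 1"
  using assms
proof (induction S)
  case (insert k S)
  have gcd: "z ^ gcd a b = 1" if "z ^ a = 1" "z ^ b = 1" for a b
  proof (cases "a = 0")
    case False
    then obtain x y where "a * x = b * y + gcd a b" using bezout_nat by blast
    then have "z ^ (a * x) = z ^ (b * y) * z ^ gcd a b" by (simp add: power_add)
    then show ?thesis using that by (simp add: power_mult)
  qed (use that in simp)
  show ?case using insert gcd[of k "Gcd S"] by simp
qed simp

text \<open>If all sums vanished for some \<open>\<omega> \<noteq> 1\<close>, then
  \<open>\<omega> ^ k = 1\<close> for every row size \<open>k\<close>, hence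
  \<open>\<omega> = 1\<close> because the sizes have greatest common divisor 1. For
  \<open>\<omega> = 1\<close> the sums are the row sizes themselves.\<close>

lemma geometric_row_sum_nonzero:
  fixes \<omega> :: complex
  assumes F: "finite F" and rp: "Gcd (row_cards u F) = 1"
  obtains b where "b \<in> det2 u ` F" "(\<Sum>i<card (lattice_row u F b). \<omega> ^ i) \<noteq> 0"
proof (cases "\<omega> = 1")
  case True
  have "F \<noteq> {}" using rp by (auto simp: row_cards_def)
  then obtain y where y: "y \<in> F" by blast
  then have "y \<in> lattice_row u F (det2 u y)" by (simp add: lattice_row_def)
  then have "card (lattice_row u F (det2 u y)) > 0"
    using finite_subset[OF _ F, of "lattice_row u F (det2 u y)"]
    unfolding card_gt_0_iff by (auto simp only: lattice_row_def)
  then have "(\<Sum>i<card (lattice_row u F (det2 u y)). \<omega> ^ i) \<noteq> 0" using True by simp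
  then show thesis by (rule that[OF imageI[OF y]])
next
  case False
  have "finite (row_cards u F)" using F by (simp add: row_cards_def)
  then obtain k where "k \<in> row_cards u F" "\<omega> ^ k \<noteq> 1"
    using root_of_unity_Gcd[of "row_cards u F" \<omega>] rp False by auto
  then show thesis using False that by (auto simp: row_cards_def geometric_sum)
qed

text \<open>Along a row the values of \<open>d\<close> form a geometric progression, so the row
  contributes a geometric sum times the value at one point. Shifting that point along
  \<open>u\<close> to a multiple of \<open>w\<close> costs a nonzero factor, and the sum over
  \<open>F\<close> becomes a recurrence in direction \<open>w\<close>.\<close>

lemma eigenfunction_periodic:
  fixes d :: "point \<Rightarrow> complex"
  assumes F: "convex_figure F" "finite F" and u: "coprime (fst u) (snd u)"
    and rp: "Gcd (row_cards u F) = 1" and w: "det2 u w = 1"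
    and fin: "finite (range d)" and eig: "\<And>x. d (x + u) = \<omega> * d x" "\<omega> \<noteq> 0"
    and sum: "\<And>x. (\<Sum>y\<in>F. d (x + y)) = \<kappa>"
  shows "\<exists>N>0. period d (int_scale N w)"
proof -
  have eig_nat: "d (x + int_scale (int i) u) = \<omega> ^ i * d x" for x i
  proof (induction i)
    case (Suc i)
    then show ?case unfolding add_int_scale_Suc by (simp add: eig)
  qed simp
  have eig_int: "\<exists>\<mu>. \<mu> \<noteq> 0 \<and> (\<forall>x. d (x + int_scale a u) = \<mu> * d x)" for a
  proof (cases "a \<ge> 0")
    case True
    have "d (x + int_scale a u) = \<omega> ^ nat a * d x" for x
      using eig_nat[of x "nat a"] True by simp
    then show ?thesis using eig(2) by (intro exI[of _ "\<omega> ^ nat a"]) simp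
  next
    case False
    have "d (x + int_scale a u) = inverse (\<omega> ^ nat (- a)) * d x" for x
      using eig_nat[of "x + int_scale a u" "nat (- a)"] False eig(2)
      by (simp add: add.assoc field_simps flip: int_scale_add)
    then show ?thesis using eig(2) by (intro exI[of _ "inverse (\<omega> ^ nat (- a))"]) simp
  qed
  let ?B = "det2 u ` F" and ?g = "\<lambda>b. \<Sum>i<card (lattice_row u F b). \<omega> ^ i"
  have "\<exists>\<mu>. \<mu> \<noteq> 0 \<and> (\<forall>x. (\<Sum>y\<in>lattice_row u F b. d (x + y)) = ?g b * \<mu> * d (x + int_scale b w))"
    if "b \<in> ?B" for b
  proof -
    have "lattice_row u F b \<noteq> {}" using that by (auto simp: lattice_row_def)
    then obtain p where p: "det2 u p = b"
      "bij_betw (\<lambda>i. p + int_scale (int i) u) {..<card (lattice_row u F b)} (lattice_row u F b)"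
      using row_progression[OF F u] by metis
    obtain \<mu> where \<mu>: "\<mu> \<noteq> 0" "\<And>x. d (x + int_scale (det2 p w) u) = \<mu> * d x"
      using eig_int by metis
    have split: "p = int_scale b w + int_scale (det2 p w) u"
      unfolding p(1)[symmetric] by (subst add.commute) (rule basis_coordinates[OF w])
    have "(\<Sum>y\<in>lattice_row u F b. d (x + y)) = ?g b * \<mu> * d (x + int_scale b w)" for x
    proof -
      have "(\<Sum>y\<in>lattice_row u F b. d (x + y)) = (\<Sum>i<card (lattice_row u F b). d (x + p + int_scale (int i) u))"
        by (subst sum.reindex_bij_betw[OF p(2), symmetric]) (simp add: add.assoc)
      also have "\<dots> = ?g b * d (x + p)" by (simp add: eig_nat sum_distrib_right)
      also have "d (x + p) = \<mu> * d (x + int_scale b w)"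
        by (subst split) (simp add: \<mu>(2) flip: add.assoc)
      finally show ?thesis by (simp add: mult.assoc)
    qed
    then show ?thesis using \<mu>(1) by blast
  qed
  then obtain \<mu> where \<mu>: "\<And>b. b \<in> ?B \<Longrightarrow> \<mu> b \<noteq> 0"
    "\<And>b x. b \<in> ?B \<Longrightarrow> (\<Sum>y\<in>lattice_row u F b. d (x + y)) = ?g b * \<mu> b * d (x + int_scale b w)"
    by metis
  obtain b where b: "b \<in> ?B" "?g b \<noteq> 0"
    using geometric_row_sum_nonzero[OF F(2) rp] .
  show ?thesis
  proof (rule linear_recurrence_periodic[OF fin])
    show "finite ?B" using F by simp
    show "b \<in> ?B" "?g b * \<mu> b \<noteq> 0" using b \<mu>(1) by auto
    show "(\<Sum>b\<in>?B. (?g b * \<mu> b) * d (x + int_scale b w)) = \<kappa>" for x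
      using sum[of x] \<mu>(2) by (simp add: sum_rows[OF F(2), of _ u])
  qed
qed

text \<open>Orthogonality of the characters of the cyclic group of order \<open>n\<close>, for
  Fourier inversion.\<close>

lemma sum_roots_of_unity:
  assumes "n > 0"
  shows "(\<Sum>j<n. inverse (cis (2 * pi * real j / real n)) ^ k) = (if n dvd k then of_nat n else 0)"
proof -
  define z where "z = inverse (cis (2 * pi * real k / real n))"
  have pow: "inverse (cis (2 * pi * real j / real n)) ^ k = z ^ j" for j
    by (simp add: z_def power_inverse[symmetric] Complex.DeMoivre mult_ac)
  have "cis (2 * pi * real k / real n) ^ n = 1"
    using assms by (simp add: Complex.DeMoivre cis_multiple_2pi)
  then have zn: "z ^ n = 1" by (metis z_def power_inverse inverse_1)
  have z1: "z = 1 \<longleftrightarrow> n dvd k"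
  proof -
    have "z = 1 \<longleftrightarrow> cis (2 * pi * real k / real n) = 1"
      unfolding z_def by (rule inverse_eq_1_iff)
    also have "\<dots> \<longleftrightarrow> exp (2 * of_real pi * \<i> * of_nat k / of_nat n) = 1"
      by (simp add: cis_conv_exp mult_ac)
    also have "\<dots> \<longleftrightarrow> n dvd k" using complex_root_unity_eq_1[of n k] assms by simp
    finally show ?thesis .
  qed
  show ?thesis
  proof (cases "z = 1")
    case True
    then show ?thesis unfolding pow using z1 by simp
  next
    case False
    then show ?thesis unfolding pow using z1 zn by (simp add: geometric_sum)
  qed
qed

text \<open>Discrete Fourier transform along \<open>u\<close>: a function with period \<open>n u\<close> is a sum of
  \<open>n\<close> eigenfunctions of the shift by \<open>u\<close>.\<close>

lemma lattice_periodic_if_periodic: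
  fixes d :: "point \<Rightarrow> complex"
  assumes F: "convex_figure F" "finite F" and u: "coprime (fst u) (snd u)"
    and rp: "Gcd (row_cards u F) = 1" and n: "n > 0"
    and fin: "finite (range d)" and per: "period d (int_scale (int n) u)"
    and sum: "\<And>x. (\<Sum>y\<in>F. d (x + y)) = \<kappa>"
  shows "lattice_periodic d"
proof -
  obtain w where w: "det2 u w = 1" using complementary_vector[OF u] .
  define \<omega> where "\<omega> j = cis (2 * pi * real j / real n)" for j :: nat
  have \<omega>: "\<omega> j \<noteq> 0" "\<omega> j ^ n = 1" for j
    using n by (simp_all add: \<omega>_def Complex.DeMoivre cis_multiple_2pi)
  \<comment> \<open>The Fourier components are left unnormalised, hence the factor \<open>n\<close>
    in \<open>inversion\<close>.\<close>
  define e where "e j x = (\<Sum>k<n. inverse (\<omega> j) ^ k * d (x + int_scale (int k) u))" for j x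
  have "\<exists>N>0. period (e j) (int_scale N w)" for j
  proof (rule eigenfunction_periodic[OF F u rp w])
    show "finite (range (e j))"
      unfolding e_def by (intro finite_range_sum finite_range_mult_shift fin)
    show "e j (x + u) = \<omega> j * e j x" for x
    proof -
      define h where "h k = inverse (\<omega> j) ^ k * d (x + int_scale (int k) u)" for k
      have "e j (x + u) = (\<Sum>k<n. \<omega> j * h (Suc k))"
        unfolding e_def h_def using \<omega>(1)
        by (intro sum.cong) (auto simp: int_scale_add add.assoc)
      also have "\<dots> = \<omega> j * (\<Sum>k<n. h (Suc k))" by (simp add: sum_distrib_left)
      also have "(\<Sum>k<n. h (Suc k)) = (\<Sum>k<n. h k) + h n - h 0"
        by (induction n) (simp_all add: algebra_simps)
      \<comment> \<open>The period of \<open>d\<close> and \<open>\<omega> j ^ n = 1\<close> make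
        the index cyclic, so the shifted sum equals the original one.\<close>
      also have "h n = h 0" using \<omega>(2) periodD[OF per] by (simp add: h_def power_inverse)
      finally show ?thesis by (simp add: e_def h_def)
    qed
    show "(\<Sum>y\<in>F. e j (x + y)) = (\<Sum>k<n. inverse (\<omega> j) ^ k * \<kappa>)" for x
    proof -
      have "(\<Sum>y\<in>F. e j (x + y))
          = (\<Sum>k<n. inverse (\<omega> j) ^ k * (\<Sum>y\<in>F. d (x + int_scale (int k) u + y)))"
        unfolding e_def sum_distrib_left
        by (subst sum.swap) (simp add: add_ac)
      then show ?thesis by (simp add: sum)
    qed
    show "\<omega> j \<noteq> 0" by (rule \<omega>)
  qed
  then obtain N where N: "\<And>j. N j > 0" "\<And>j. period (e j) (int_scale (N j) w)" by metis
  define M where "M = (\<Prod>j<n. N j)"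
  have M: "M > 0" using N by (simp add: M_def prod_pos)
  have eM: "period (e j) (int_scale M w)" if "j < n" for j
  proof -
    have "N j dvd M" unfolding M_def using that by (intro dvd_prodI) auto
    then obtain m where m: "M = m * N j" by (metis dvd_def mult.commute)
    then show ?thesis using period_int_scale[OF N(2), of j m] by simp
  qed
  have inversion: "(\<Sum>j<n. e j x) = of_nat n * d x" for x
  proof -
    have "(\<Sum>j<n. e j x) = (\<Sum>k<n. (\<Sum>j<n. inverse (\<omega> j) ^ k) * d (x + int_scale (int k) u))"
      unfolding e_def by (subst sum.swap) (simp add: sum_distrib_right)
    also have "\<dots> = (\<Sum>k<n. if k = 0 then of_nat n * d x else 0)"
      unfolding \<omega>_def sum_roots_of_unity[OF n]
      by (intro sum.cong) (auto dest: dvd_imp_le)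
    also have "\<dots> = of_nat n * d x" using n by simp
    finally show ?thesis .
  qed
  have dM: "period d (int_scale M w)"
  proof (rule periodI)
    fix x
    have "(\<Sum>j<n. e j (x + int_scale M w)) = (\<Sum>j<n. e j x)"
      by (intro sum.cong) (simp_all add: periodD[OF eM])
    then show "d (x + int_scale M w) = d x" using n by (simp add: inversion)
  qed
  have "period d (int_scale (int n * M) v)" for v
  proof -
    have "int_scale (int n * M) v = int_scale (det2 v w * M) (int_scale (int n) u)
        + int_scale (det2 u v * int n) (int_scale M w)"
      using arg_cong[OF basis_coordinates[OF w, of v], of "int_scale (int n * M)"]
      by (simp add: int_scale_add_right mult_ac)
    also have "period d \<dots>" by (intro period_add period_int_scale per dM)
    finally show ?thesis .
  qed
  then show ?thesis using n M unfolding lattice_periodic_def by (intro exI[of _ "int n * M"]) auto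
qed

text \<open>Induction on the number of binomials: removing the first one leaves a \<open>v\<close>-periodic function,
  which is periodic in all directions; hence the second binomial can be squared at the expense of the
  first one, and squares are redundant for bounded functions.\<close>

lemma lattice_periodic_if_annihilated:
  fixes c :: "point \<Rightarrow> int"
  assumes F: "convex_figure F" "finite F"
    and rp: "\<And>u. u \<noteq> 0 \<Longrightarrow> Gcd (row_cards u F) = 1"
    and fin: "finite (range c)" and sum: "\<And>x. (\<Sum>y\<in>F. c (x + y)) = \<kappa>"
    and vs: "0 \<notin> set vs" "\<And>x. act (prod_list (map (\<lambda>v. 1 - mono_at v) vs)) c x = 0"
  shows "lattice_periodic c"
  using vs
proof (induction "length vs" arbitrary: vs)
  case 0
  then have "c x = 0" for x by simp
  then show ?case unfolding lattice_periodic_def period_def by (intro exI[of _ 1]) simp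
next
  case (Suc l)
  then obtain v ws where vs: "vs = v # ws" by (cases vs) auto
  have act_binomial: "act (1 - mono_at p) f x = f x - f (x + p)" for p x and f :: "point \<Rightarrow> int"
    by (simp add: act_diff act_single)
  define d where "d = act (prod_list (map (\<lambda>v. 1 - mono_at v) ws)) c"
  have "period d v"
    using Suc.prems(2) by (intro periodI) (simp add: vs act_mult act_binomial d_def)
  obtain n u where nu: "n > 0" "v = int_scale (int n) u" "coprime (fst u) (snd u)"
    using primitive_vector[of v] Suc.prems vs by (metis list.set_intros(1))
  have "u \<noteq> 0" using nu(3) by (auto simp: zero_prod_def)
  have "lattice_periodic (\<lambda>x. of_int (d x) :: complex)"
  proof (rule lattice_periodic_if_periodic[OF F nu(3) rp[OF \<open>u \<noteq> 0\<close>] nu(1)])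
    have "finite (range d)" unfolding d_def by (intro finite_range_act fin)
    then show "finite (range (\<lambda>x. of_int (d x) :: complex))"
      using finite_imageI[of "range d"] by (simp add: image_image)
    show "period (\<lambda>x. of_int (d x) :: complex) (int_scale (int n) u)"
      using periodD[OF \<open>period d v\<close>] nu(2) by (intro periodI) simp
    \<comment> \<open>The sums of \<open>d\<close> over \<open>F\<close> come from the same
      polynomial acting on a constant function, so they do not depend on \<open>x\<close>.\<close>
    have "(\<Sum>y\<in>F. d (x + y)) = act (prod_list (map (\<lambda>v. 1 - mono_at v) ws)) (\<lambda>_. \<kappa>) 0" for x
      unfolding d_def sum_act by (simp add: sum act_def)
    then show "(\<Sum>y\<in>F. of_int (d (x + y)) :: complex)
        = of_int (act (prod_list (map (\<lambda>v. 1 - mono_at v) ws)) (\<lambda>_. \<kappa>) 0)" for x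
      by (simp flip: of_int_sum)
  qed
  then obtain K where K: "K > 0" "\<And>p. period d (int_scale K p)"
    by (auto simp: lattice_periodic_def period_def)
  show ?case
  proof (cases ws)
    case Nil
    then have "d = c" by (auto simp: d_def)
    then show ?thesis using K by (auto simp: lattice_periodic_def)
  next
    case (Cons p rest)
    define e where "e = act (prod_list (map (\<lambda>v. 1 - mono_at v) rest)) c"
    have d: "d = (\<lambda>x. e x - e (x + p))"
      by (auto simp: d_def e_def Cons act_mult act_binomial)
    have telescope: "e x - e (x + int_scale (int k) p) = (\<Sum>i<k. d (x + int_scale (int i) p))" for x k
    proof (induction k)
      case (Suc k)
      have "d (x + int_scale (int k) p)
          = e (x + int_scale (int k) p) - e (x + int_scale (int k) p + p)" by (simp add: d)
      then show ?case using Suc unfolding sum.lessThan_Suc add_int_scale_Suc by linarith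
    qed simp
    \<comment> \<open>The difference of \<open>e\<close> along \<open>int_scale K p\<close> is a sum
      of \<open>K\<close> values of \<open>d\<close>, which all have the period
      \<open>int_scale K p\<close>.\<close>
    have diff: "period (\<lambda>x. e x - e (x + int_scale K p)) (int_scale K p)"
    proof (rule periodI)
      fix x
      have "d (x + int_scale K p + q) = d (x + q)" for q
        using periodD[OF K(2), of "x + q" p] by (simp add: add_ac)
      then show "e (x + int_scale K p) - e (x + int_scale K p + int_scale K p) = e x - e (x + int_scale K p)"
        using telescope[of _ "nat K"] K(1) by simp
    qed
    have "finite (range e)" unfolding e_def by (intro finite_range_act fin)
    then have e: "period e (int_scale K p)" by (rule period_if_second_difference_zero[OF _ diff])
    \<comment> \<open>The binomials for \<open>v\<close> and \<open>p\<close> are traded for the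
      single one for \<open>int_scale K p\<close>. The new list is not a tail of the old one, so the
      induction runs on the length.\<close>
    have "act (prod_list (map (\<lambda>v. 1 - mono_at v) (int_scale K p # rest))) c x = 0" for x
      by (simp add: act_mult act_binomial periodD[OF e] flip: e_def)
    then show ?thesis
      using Suc.hyps(2) Suc.prems(1) K(1) by (intro Suc.hyps(1)[of "int_scale K p # rest"]) (auto simp: vs Cons)
  qed
qed

section \<open>Abelian rigidity\<close>

lemma translate_translate: "translate v (translate t F) = translate (t + v) F"
  by (simp add: translate_def image_image add.assoc)

lemma pattern_eq_range_translate:
  assumes "is_pattern P" "F \<in> P"
  shows "finite F" "P = range (\<lambda>v. translate v F)"
proof -
  obtain F0 t where F0: "finite F0" "P = range (\<lambda>v. translate v F0)" "F = translate t F0"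
    using assms by (auto simp: is_pattern_def)
  show "finite F" using F0 by (simp add: translate_def)
  have 1: "translate v F0 = translate (v - t) F" and 2: "translate v F = translate (t + v) F0" for v
    by (simp_all add: F0(3) translate_translate)
  show "P = range (\<lambda>v. translate v F)"
    unfolding F0(2)
    by (intro equalityI image_subsetI) (rule range_eqI, rule 1, rule range_eqI, rule 2)
qed

lemma sum_indicator_eq_abelian_vector:
  assumes "finite F"
  shows "(\<Sum>y\<in>F. if w (x + y) = a then 1 else 0) = (of_nat (abelian_vector w (translate x F) a) :: 'b::semiring_1)"
proof -
  have "{z \<in> translate x F. w z = a} = (\<lambda>y. y + x) ` {y \<in> F. w (x + y) = a}"
    by (auto simp: translate_def add.commute)
  moreover have "inj_on (\<lambda>y. y + x) {y \<in> F. w (x + y) = a}" by (rule inj_onI) simp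
  ultimately have "abelian_vector w (translate x F) a = card {y \<in> F. w (x + y) = a}"
    unfolding abelian_vector_def by (simp only: card_image)
  then show ?thesis using assms by (simp add: sum.inter_filter[symmetric])
qed

lemma letter_lattice_periodic:
  assumes F: "convex_figure F" "finite F" "0 \<in> F"
    and rp: "\<And>u. u \<noteq> 0 \<Longrightarrow> Gcd (row_cards u F) = 1"
    and const: "\<And>x. abelian_vector w (translate x F) a = k"
  shows "lattice_periodic (\<lambda>x. if w x = a then 1 else 0 :: int)"
proof -
  define c where "c x = (if w x = a then 1 else 0 :: int)" for x
  have sum: "(\<Sum>y\<in>F. c (x + y)) = int k" for x
    using sum_indicator_eq_abelian_vector[OF F(2), of w x a] const by (simp add: c_def)
  have "range c \<subseteq> {0, 1}" by (auto simp: c_def)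
  then have fin: "finite (range c)" by (rule finite_subset) simp
  define e :: point where "e = (1, 0)"
  have "e \<noteq> 0" by (simp add: e_def zero_prod_def)
  text \<open>Differencing along \<open>e\<close> makes the sums over the translates of \<open>F\<close> vanish.\<close>
  define c' where "c' = act (1 - mono_at e) c"
  have "(\<Sum>y\<in>F. c' (x + y)) = 0" for x
    unfolding c'_def sum_act by (simp add: sum act_diff act_single)
  moreover have "finite (range c')" unfolding c'_def by (intro finite_range_act fin)
  ultimately obtain r where r: "r > 0"
    "\<And>x. act (\<Prod>v\<in>F - {0}. 1 - mono_at (int_scale r v)) c' x = 0"
    using prod_binomials_annihilates[OF F(2,3)] by metis
  obtain vs where vs: "set vs = F - {0}" "distinct vs"
    using finite_distinct_list[of "F - {0}"] F(2) by auto
  \<comment> \<open>As \<open>c'\<close> arises from \<open>c\<close> by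
    \<open>1 - mono_at e\<close>, appending \<open>e\<close> turns an annihilator of
    \<open>c'\<close> into one of \<open>c\<close>.\<close>
  define us where "us = map (int_scale r) vs @ [e]"
  have prod: "(\<Prod>v\<in>F - {0}. 1 - mono_at (int_scale r v)) * (1 - mono_at e)
      = (prod_list (map (\<lambda>v. 1 - mono_at v) us) :: point \<Rightarrow>\<^sub>0 int)"
    unfolding vs(1)[symmetric] prod.distinct_set_conv_list[OF vs(2)] us_def by (simp add: comp_def)
  have "lattice_periodic c"
  proof (rule lattice_periodic_if_annihilated[OF F(1,2) _ fin sum])
    show "Gcd (row_cards u F) = 1" if "u \<noteq> 0" for u by (rule rp[OF that])
    have "int_scale r v \<noteq> 0" if "v \<in> set vs" for v
      using that r(1) unfolding vs(1) by simp
    then show "0 \<notin> set us"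
      using \<open>e \<noteq> 0\<close> unfolding us_def set_append set_map list.set by (metis UnE empty_iff imageE insertE)
    show "act (prod_list (map (\<lambda>v. 1 - mono_at v) us)) c x = 0" for x
      using r(2) unfolding prod[symmetric] act_mult c'_def .
  qed
  then show ?thesis unfolding c_def .
qed

lemma lattice_periodic_if_letters:
  assumes "finite A" "range w \<subseteq> A"
    and "\<And>a. a \<in> A \<Longrightarrow> lattice_periodic (\<lambda>x. if w x = a then 1 else 0 :: int)"
  shows "lattice_periodic w"
proof -
  have "\<forall>a\<in>A. \<exists>K>0. \<forall>v. period (\<lambda>x. if w x = a then 1 else 0 :: int) (int_scale K v)"
    using assms(3) unfolding lattice_periodic_def by blast
  then obtain K where K: "\<And>a. a \<in> A \<Longrightarrow> K a > 0"
    "\<And>a v. a \<in> A \<Longrightarrow> period (\<lambda>x. if w x = a then 1 else 0 :: int) (int_scale (K a) v)"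
    unfolding bchoice_iff by blast
  define M where "M = prod K A"
  have "period w (int_scale M v)" for v
  proof (rule periodI)
    fix x
    have wx: "w x \<in> A" using assms(2) by blast
    then have "K (w x) dvd M" unfolding M_def using assms(1) by (intro dvd_prodI)
    then obtain m where "M = K (w x) * m" ..
    then have "period (\<lambda>z. if w z = w x then 1 else 0 :: int) (int_scale M v)"
      using K(2)[OF wx, of "int_scale m v"] by simp
    from periodD[OF this, of x] show "w (x + int_scale M v) = w x" by (simp split: if_splits)
  qed
  moreover have "M > 0" unfolding M_def using K(1) by (intro prod_pos) auto
  ultimately show ?thesis unfolding lattice_periodic_def by blast
qed

lemma fully_periodic_if_lattice_periodic:
  assumes "lattice_periodic w"
  shows "fully_periodic w"
proof -
  obtain K where K: "K > 0" "\<And>v. period w (int_scale K v)"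
    using assms by (auto simp: lattice_periodic_def)
  let ?p = "(K, 0)" and ?q = "(0, K)"
  have "period w ?p" "period w ?q"
    using K(2)[of "(1, 0)"] K(2)[of "(0, 1)"] by (simp_all add: int_scale_def)
  moreover have "independent {embed ?p, embed ?q}"
    using K(1) by (auto simp: independent_insert span_singleton embed_def zero_prod_def)
  moreover have "?p \<noteq> ?q" using K(1) by simp
  ultimately show ?thesis unfolding fully_periodic_def by blast
qed

section \<open>The converse: constant abelian vectors without full periodicity\<close>

lemma sum_residues:
  assumes "n > 0"
  shows "(\<Sum>i<n. f ((s + int i) mod int n)) = sum f {0..<int n}"
proof -
  let ?h = "\<lambda>i. (s + int i) mod int n"
  have inj: "inj_on ?h {..<n}"
  proof (rule inj_onI)
    fix i j assume ij: "i \<in> {..<n}" "j \<in> {..<n}" "?h i = ?h j"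
    then have "int n dvd int i - int j" by (simp add: mod_eq_dvd_iff)
    then have "int i - int j = 0"
      using ij(1,2) zdvd_imp_le[of "int n" "\<bar>int i - int j\<bar>"] by (cases "i = j") auto
    then show "i = j" by simp
  qed
  have "?h ` {..<n} = {0..<int n}"
    by (rule card_subset_eq) (use assms card_image[OF inj] in auto)
  then show ?thesis using sum.reindex[OF inj, of f] by (simp add: comp_def)
qed

lemma sum_residues_multiple:
  fixes f :: "int \<Rightarrow> nat"
  assumes "n > 0"
  shows "(\<Sum>i<m * n. f ((s + int i) mod int n)) = m * sum f {0..<int n}"
proof -
  have "(\<Sum>i<m * n. f ((s + int i) mod int n))
      = (\<Sum>j<m. \<Sum>i\<in>{j * n..<j * n + n}. f ((s + int i) mod int n))"
    by (rule sum.nat_group[symmetric])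
  also have "\<dots> = (\<Sum>j<m. \<Sum>i<n. f ((s + int (j * n) + int i) mod int n))"
    using sum.shift_bounds_nat_ivl[of "\<lambda>i. f ((s + int i) mod int n)" 0 "j * n" n for j]
    by (simp add: lessThan_atLeast0 algebra_simps)
  also have "\<dots> = m * sum f {0..<int n}" by (simp add: sum_residues[OF assms])
  finally show ?thesis .
qed

text \<open>Two independent periods cannot both be parallel to \<open>u\<close>. A transversal one
  carries each line parallel to \<open>u\<close> to a different line.\<close>

lemma fully_periodic_transversal_period:
  assumes "fully_periodic w" "det2 u v = 1"
  obtains p where "period w p" "det2 u p \<noteq> 0"
proof -
  obtain p q where pq: "p \<noteq> q" "independent {embed p, embed q}" "period w p" "period w q"
    using assms(1) by (auto simp: fully_periodic_def)
  have "det2 u p \<noteq> 0 \<or> det2 u q \<noteq> 0"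
  proof (rule ccontr)
    assume "\<not> ?thesis"
    then have 0: "det2 u p = 0" "det2 u q = 0" by auto
    obtain a b where ab: "p = int_scale a u" "q = int_scale b u"
      using basis_coordinates[OF assms(2), of p] basis_coordinates[OF assms(2), of q]
      unfolding 0 by auto
    have emb: "embed (int_scale k u) = real_of_int k *\<^sub>R embed u" for k
      by (simp add: embed_def int_scale_def)
    have "embed q \<noteq> 0" using pq(2) dependent_zero[of "{embed p, embed q}"] by auto
    then have "b \<noteq> 0" unfolding ab(2) emb by auto
    have "embed p = (real_of_int a / real_of_int b) *\<^sub>R embed q"
      unfolding ab emb using \<open>b \<noteq> 0\<close> by simp
    then have "embed p \<in> span {embed q}" unfolding span_singleton by (rule range_eqI)
    moreover have "embed p \<noteq> embed q" using pq(1) by (auto simp: embed_def prod_eq_iff)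
    ultimately show False using pq(2) by (simp add: independent_insert)
  qed
  then show thesis using that pq by blast
qed

text \<open>If every line meets the figure in a multiple of \<open>n\<close> points, colour each line parallel to \<open>u\<close>
  by a residue class modulo \<open>n\<close>; the phase may be chosen freely on each line, so shift it on one.\<close>

lemma not_abelian_rigid_if_common_divisor:
  assumes P: "convex_pattern P" "F \<in> P" and u: "coprime (fst u) (snd u)"
    and n: "n \<ge> 2" "\<And>k. k \<in> row_cards u F \<Longrightarrow> n dvd k"
  shows "\<not> abelian_rigid P"
proof
  assume rigid: "abelian_rigid P"
  have "is_pattern P" and F: "convex_figure F" using P by (auto simp: convex_pattern_def)
  note pattern = pattern_eq_range_translate[OF this(1) P(2)]
  obtain v where v: "det2 u v = 1" using complementary_vector[OF u] .
  \<comment> \<open>The letter 1 sits where the coordinate along \<open>u\<close> is congruent to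
    the phase modulo \<open>n\<close>. The phase is 1 on the line through the origin and 0 on all
    others.\<close>
  define w where "w y = (if (det2 y v - (if det2 u y = 0 then 1 else 0)) mod int n = 0 then 1 else 0 :: nat)" for y
  define S where "S a = (\<Sum>r\<in>{0..<int n}. if (if r = 0 then 1 else 0 :: nat) = a then 1 else 0 :: nat)" for a
  have row_sum: "(\<Sum>y\<in>lattice_row u F b. if w (x + y) = a then 1 else 0) = card (lattice_row u F b) div n * S a"
    if "b \<in> det2 u ` F" for b x a
  proof -
    have "lattice_row u F b \<noteq> {}" using that by (auto simp: lattice_row_def)
    then obtain p where p: "det2 u p = b"
      "bij_betw (\<lambda>i. p + int_scale (int i) u) {..<card (lattice_row u F b)} (lattice_row u F b)"
      using row_progression[OF F pattern(1) u] by blast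
    define s where "s = det2 (x + p) v - (if det2 u (x + p) = 0 then 1 else 0)"
    have "w (x + (p + int_scale (int i) u)) = (if (s + int i) mod int n = 0 then 1 else 0)" for i
      by (simp add: w_def s_def det2_add det2_add_left v algebra_simps)
    then have "(\<Sum>y\<in>lattice_row u F b. if w (x + y) = a then 1 else 0)
        = (\<Sum>i<card (lattice_row u F b). if (if (s + int i) mod int n = 0 then 1 else 0 :: nat) = a then 1 else 0 :: nat)"
      by (subst sum.reindex_bij_betw[OF p(2), symmetric]) simp
    also have "card (lattice_row u F b) = card (lattice_row u F b) div n * n"
      using n(2) that by (simp add: row_cards_def)
    also have "(\<Sum>i<\<dots>. if (if (s + int i) mod int n = 0 then 1 else 0 :: nat) = a then 1 else 0 :: nat)
        = card (lattice_row u F b) div n * S a"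
      unfolding S_def by (rule sum_residues_multiple) (use n in simp)
    finally show ?thesis .
  qed
  have "abelian_vector w (translate x F) = (\<lambda>a. \<Sum>b\<in>det2 u ` F. card (lattice_row u F b) div n * S a)" for x
  proof
    fix a
    have "abelian_vector w (translate x F) a = (\<Sum>y\<in>F. if w (x + y) = a then 1 else 0)"
      by (simp add: sum_indicator_eq_abelian_vector[OF pattern(1)])
    also have "\<dots> = (\<Sum>b\<in>det2 u ` F. card (lattice_row u F b) div n * S a)"
      unfolding sum_rows[OF pattern(1), of _ u] by (intro sum.cong refl row_sum)
    finally show "abelian_vector w (translate x F) a = \<dots>" .
  qed
  then have "abelian_vector w ` P = {\<lambda>a. \<Sum>b\<in>det2 u ` F. card (lattice_row u F b) div n * S a}"
    unfolding pattern(2) image_image by (simp only: image_constant_conv) simp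
  then have "abelian_complexity w P = 1" by (simp add: abelian_complexity_def)
  moreover have "range w \<subseteq> {0, 1}" by (auto simp: w_def)
  ultimately have "fully_periodic w"
    using rigid[unfolded abelian_rigid_def, rule_format, of "{0, 1}" w] by simp
  then obtain p where p: "period w p" "det2 u p \<noteq> 0"
    using fully_periodic_transversal_period v by metis
  \<comment> \<open>The point \<open>u\<close> has coordinate 1 on the line with phase 1. Moving by
    \<open>int_scale (int n) p\<close> leaves this line but keeps the coordinate modulo
    \<open>n\<close>, and \<open>n \<ge> 2\<close> keeps 1 apart from 0.\<close>
  have "w u = 1" using v by (simp add: w_def)
  moreover have "w (u + int_scale (int n) p) = 0"
    using p(2) n(1) v by (simp add: w_def det2_add det2_add_left mod_add_eq)
  ultimately show False using periodD[OF period_int_scale[OF p(1), of "int n"], of u] by simp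
qed

theorem theorem4:
  fixes P :: "(int \<times> int) set set"
  assumes "convex_pattern P"
  shows "relatively_prime P \<longleftrightarrow> abelian_rigid P"
proof
  assume "relatively_prime P"
  then have rp: "Gcd (row_cards u F) = 1" if "u \<noteq> 0" "F \<in> P" for u F
    using that dir_relatively_prime_iff[OF that(1)] unfolding relatively_prime_def by blast
  obtain F0 where F0: "F0 \<in> P" using assms by (auto simp: convex_pattern_def is_pattern_def)
  have P: "is_pattern P" using assms by (simp add: convex_pattern_def)
  \<comment> \<open>The empty figure has greatest common divisor 0, so \<open>F0\<close> has a
    point. It is translated to the origin because \<open>prod_binomials_annihilates\<close> asks for
    \<open>0 \<in> F\<close>.\<close>
  have "F0 \<noteq> {}" using rp[OF _ F0, of "(1, 0)"] by (auto simp: row_cards_def zero_prod_def)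
  then obtain y0 where y0: "y0 \<in> F0" by blast
  define F where "F = translate (- y0) F0"
  have "F \<in> P" using pattern_eq_range_translate(2)[OF P F0] unfolding F_def by blast
  note pattern = pattern_eq_range_translate[OF P this]
  have "y0 + - y0 \<in> F" unfolding F_def translate_def using y0 by (rule imageI)
  then have "0 \<in> F" by simp
  have "convex_figure F" using assms \<open>F \<in> P\<close> by (auto simp: convex_pattern_def)
  show "abelian_rigid P"
    unfolding abelian_rigid_def
  proof (intro allI impI, elim conjE)
    fix A :: "nat set" and w
    assume A: "finite A" "range w \<subseteq> A" and "abelian_complexity w P = 1"
    then obtain c where "abelian_vector w ` P = {c}"
      by (auto simp: abelian_complexity_def card_1_singleton_iff)
    then have c: "abelian_vector w (translate x F) = c" for x
      using pattern(2) by blast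
    have "lattice_periodic (\<lambda>x. if w x = a then 1 else 0 :: int)" for a
    proof (rule letter_lattice_periodic[OF \<open>convex_figure F\<close> pattern(1) \<open>0 \<in> F\<close>])
      show "Gcd (row_cards u F) = 1" if "u \<noteq> 0" for u by (rule rp[OF that \<open>F \<in> P\<close>])
      show "abelian_vector w (translate x F) a = c a" for x by (simp only: c)
    qed
    then show "fully_periodic w"
      by (intro fully_periodic_if_lattice_periodic lattice_periodic_if_letters[OF A])
  qed
next
  assume rigid: "abelian_rigid P"
  show "relatively_prime P"
  proof (rule ccontr)
    assume "\<not> relatively_prime P"
    then obtain v F where vF: "v \<noteq> 0" "F \<in> P" "Gcd (row_cards v F) \<noteq> 1"
      unfolding relatively_prime_def using dir_relatively_prime_iff by blast
    obtain m u where u: "m > 0" "v = int_scale (int m) u" "coprime (fst u) (snd u)"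
      using primitive_vector[OF vF(1)] .
    define g where "g = Gcd (row_cards u F)"
    have g: "g \<noteq> 1" using vF(3) u(1,2) by (simp add: g_def row_cards_int_scale)
    text \<open>The empty figure has greatest common divisor 0, hence every number divides its row sizes.\<close>
    define n where "n = (if g = 0 then 2 else g)"
    have "n \<ge> 2" using g by (auto simp: n_def)
    moreover have "n dvd k" if "k \<in> row_cards u F" for k
      using Gcd_dvd[OF that] by (auto simp: n_def simp flip: g_def)
    ultimately show False
      using not_abelian_rigid_if_common_divisor[OF assms vF(2) u(3)] rigid by blast
  qed
qed

end
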